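(* Let $\widehat\beta^{(m)}_{PPLS}$ be the penalized PLS regression vector after $m$ steps and let $\beta_m$ be the approximate solution after $m$ steps of the conjugate gradient algorithm applied to the preconditioned system $A_M\beta=b_M$ (both defined in the context). Then the penalized PLS algorithm is equal to this conjugate gradient algorithm, i.e. for every $m\ge 1$ such that the penalized PLS components $t_1,\dots,t_m$ are nonzero, $$\widehat\beta^{(m)}_{PPLS}=\beta_m .$$
   Context: Let $X\in\mathbb{R}^{n\times p}$ and $y\in\mathbb{R}^n$ be centered. Let $P\in\mathbb{R}^{p\times p}$ be a symmetric matrix such that $I_p+P$ is positive definite, and let $M=(I_p+P)^{-1}$. For a matrix $V$, $\mathcal{P}_V=V(V^TV)^{-}V^T$ denotes the orthogonal projection onto the column space of $V$. Penalized PLS: set $X_1=X$ and for $i=1,2,\dots$ let $w_i=MX_i^Ty$ (weight vector), $t_i=X_iw_i$ (component), $X_{i+1}=X_i-\mathcal{P}_{t_i}X_i$ (deflation). Assume $t_1,\dots,t_m\neq 0$. For $i\le m$, the effective weight vector $\widetilde w_i$ is the unique vector in $\mathrm{span}\{w_1,\dots,w_i\}$ with $X\widetilde w_i=t_i$. With $T=(t_1,\dots,t_m)$ the fitted response is $\widehat y=\mathcal{P}_Ty$, and the penalized PLS regression vector after $m$ steps is $\widehat\beta^{(m)}_{PPLS}=\sum_{i=1}^m\frac{t_i^Ty}{t_i^Tt_i}\widetilde w_i$, so that $X\widehat\beta^{(m)}_{PPLS}=\widehat y$. Preconditioned system: $A=X^TX$, $b=X^Ty$, $A_M=MA$, $b_M=Mb$,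 and $\langle x,\tilde x\rangle_{M^{-1}}=x^TM^{-1}\tilde x$. Conjugate gradient algorithm for $A_M\beta=b_M$ (with respect to $\langle\cdot,\cdot\rangle_{M^{-1}}$): start with $\beta_0=0$, $d_0=r_0=b_M-A_M\beta_0=b_M$, and for $k=0,1,2,\dots$ compute $$a_k=\frac{\langle d_k,r_k\rangle_{M^{-1}}}{\langle d_k,A_Md_k\rangle_{M^{-1}}},\quad \beta_{k+1}=\beta_k+a_kd_k,\quad r_{k+1}=b_M-A_M\beta_{k+1},\quad d_{k+1}=r_{k+1}-\sum_{i=0}^{k}\frac{\langle r_{k+1},A_Md_i\rangle_{M^{-1}}}{\langle d_i,A_Md_i\rangle_{M^{-1}}}d_i .$$ *)

theory Defs
  imports "HOL-Analysis.Analysis"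
begin

definition centered :: "real ^ 'n \<Rightarrow> bool" where
  "centered v \<longleftrightarrow> (\<Sum>i\<in>UNIV. v $ i) = 0"

definition centered_matrix :: "real ^ 'p ^ 'n \<Rightarrow> bool" where
  "centered_matrix X \<longleftrightarrow> (\<forall>j. centered (column j X))"

definition symmetric_matrix :: "real ^ 'p ^ 'p \<Rightarrow> bool" where
  "symmetric_matrix A \<longleftrightarrow> transpose A = A"

definition positive_definite :: "real ^ 'p ^ 'p \<Rightarrow> bool" where
  "positive_definite A \<longleftrightarrow> symmetric_matrix A \<and> (\<forall>x. x \<noteq> 0 \<longrightarrow> x \<bullet> (A *v x) > 0)"

text \<open>
  Some generalized inverse (g-inverse) of \<open>A\<close>. Every matrix has one, and the projection
  below does not depend on the choice.
\<close>

definition generalized_inverse :: "real ^ 'k ^ 'm \<Rightarrow> real ^ 'm ^ 'k" where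
  "generalized_inverse A = (SOME G. A ** G ** A = A)"

definition proj_matrix :: "real ^ 'k ^ 'n \<Rightarrow> real ^ 'n ^ 'n" where
  "proj_matrix V = V ** generalized_inverse (transpose V ** V) ** transpose V"

text \<open>
  In the following, \<open>Z\<close> stands for a deflated matrix \<open>X\<^sub>i\<close>. A vector \<open>t\<close> is turned into the
  one-column matrix \<open>columnvector t\<close> in order to form its projection matrix.
\<close>

definition ppls_weight_of :: "real ^ 'p ^ 'p \<Rightarrow> real ^ 'n \<Rightarrow> real ^ 'p ^ 'n \<Rightarrow> real ^ 'p" where
  "ppls_weight_of M y Z = M *v (transpose Z *v y)"

definition ppls_deflate :: "real ^ 'p ^ 'p \<Rightarrow> real ^ 'n \<Rightarrow> real ^ 'p ^ 'n \<Rightarrow> real ^ 'p ^ 'n" where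
  "ppls_deflate M y Z =
     Z - proj_matrix (columnvector (Z *v ppls_weight_of M y Z) :: real ^ 1 ^ 'n) ** Z"

text \<open>The index \<open>i\<close> starts at 1; the values at \<open>i = 0\<close> are never used.\<close>

definition ppls_X :: "real ^ 'p ^ 'p \<Rightarrow> real ^ 'p ^ 'n \<Rightarrow> real ^ 'n \<Rightarrow> nat \<Rightarrow> real ^ 'p ^ 'n" where
  "ppls_X M X y i = (ppls_deflate M y ^^ (i - 1)) X"

definition ppls_weight :: "real ^ 'p ^ 'p \<Rightarrow> real ^ 'p ^ 'n \<Rightarrow> real ^ 'n \<Rightarrow> nat \<Rightarrow> real ^ 'p" where
  "ppls_weight M X y i = ppls_weight_of M y (ppls_X M X y i)"

definition ppls_component :: "real ^ 'p ^ 'p \<Rightarrow> real ^ 'p ^ 'n \<Rightarrow> real ^ 'n \<Rightarrow> nat \<Rightarrow> real ^ 'n" where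
  "ppls_component M X y i = ppls_X M X y i *v ppls_weight M X y i"

text \<open>
  The vector below exists and is unique as long as the components \<open>1, \<dots>, i\<close> are nonzero:
  they are then orthogonal, hence \<open>X\<close> is injective on the span of the first \<open>i\<close> weights.
\<close>

definition ppls_effective_weight ::
    "real ^ 'p ^ 'p \<Rightarrow> real ^ 'p ^ 'n \<Rightarrow> real ^ 'n \<Rightarrow> nat \<Rightarrow> real ^ 'p" where
  "ppls_effective_weight M X y i =
     (THE w. w \<in> span (ppls_weight M X y ` {1..i}) \<and> X *v w = ppls_component M X y i)"

definition ppls_beta :: "real ^ 'p ^ 'p \<Rightarrow> real ^ 'p ^ 'n \<Rightarrow> real ^ 'n \<Rightarrow> nat \<Rightarrow> real ^ 'p" where
  "ppls_beta M X y m =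
     (\<Sum>i = 1..m.
        (ppls_component M X y i \<bullet> y / (ppls_component M X y i \<bullet> ppls_component M X y i))
          *\<^sub>R ppls_effective_weight M X y i)"

definition matrix_inner :: "real ^ 'p ^ 'p \<Rightarrow> real ^ 'p \<Rightarrow> real ^ 'p \<Rightarrow> real" where
  "matrix_inner B u v = u \<bullet> (B *v v)"

text \<open>
  The conjugate gradient algorithm for \<open>A *v \<beta> = b\<close> with respect to an inner product \<open>ip\<close>:
  \<open>cg_iter ip A b k\<close> is the approximate solution after \<open>k\<close> steps and \<open>cg_dir ip A b k\<close>
  the search direction \<open>d\<^sub>k\<close>. The residual \<open>r\<^sub>k\<close> is inlined as \<open>b - A *v cg_iter ip A b k\<close>.
\<close>

function (sequential)
      cg_iter :: "(real ^ 'p \<Rightarrow> real ^ 'p \<Rightarrow> real) \<Rightarrow> real ^ 'p ^ 'p \<Rightarrow> real ^ 'p \<Rightarrow> nat \<Rightarrow> real ^ 'p"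
  and cg_dir :: "(real ^ 'p \<Rightarrow> real ^ 'p \<Rightarrow> real) \<Rightarrow> real ^ 'p ^ 'p \<Rightarrow> real ^ 'p \<Rightarrow> nat \<Rightarrow> real ^ 'p"
where
  "cg_iter ip A b 0 = 0"
| "cg_iter ip A b (Suc k) =
     (let d = cg_dir ip A b k;
          r = b - A *v cg_iter ip A b k
      in cg_iter ip A b k + (ip d r / ip d (A *v d)) *\<^sub>R d)"
| "cg_dir ip A b 0 = b - A *v cg_iter ip A b 0"
| "cg_dir ip A b (Suc k) =
     (let r = b - A *v cg_iter ip A b (Suc k)
      in r - (\<Sum>i = 0..k.
           (ip r (A *v cg_dir ip A b i) / ip (cg_dir ip A b i) (A *v cg_dir ip A b i))
             *\<^sub>R cg_dir ip A b i))"
  by pat_completeness auto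
termination
  by (relation "Wellfounded.measure (\<lambda>s. case s of Inl (_, _, _, k) \<Rightarrow> 2 * k | Inr (_, _, _, k) \<Rightarrow> 2 * k + 1)")
     auto

end

theory Submission
  imports Defs
begin

text \<open>
  The deflated matrix \<open>X\<^sub>i\<^sub>+\<^sub>1\<close> is \<open>X\<close> followed by the projection onto the orthogonal complement
  of \<open>t\<^sub>1, \<dots>, t\<^sub>i\<close>, so the weight \<open>w\<^sub>i\<^sub>+\<^sub>1\<close> is the residual of the preconditioned system
  at any \<open>\<beta>\<close> with \<open>X \<beta>\<close> equal to the projection of \<open>y\<close> onto the span of \<open>t\<^sub>1, \<dots>, t\<^sub>i\<close>.
  Since \<open>\<langle>u, A\<^sub>M v\<rangle> = X u \<bullet> X v\<close> in the \<open>M\<^sup>-\<^sup>1\<close> inner product, \<open>X\<close> turns the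
  \<open>A\<^sub>M\<close>-orthogonalization of the residuals into the Gram-Schmidt process that produces the
  components. By induction \<open>X d\<^sub>i = t\<^sub>i\<^sub>+\<^sub>1\<close>, which makes \<open>d\<^sub>i\<close> the effective weight of index
  \<open>i + 1\<close> and the step length \<open>a\<^sub>i\<close> the regression coefficient of \<open>y\<close> on \<open>t\<^sub>i\<^sub>+\<^sub>1\<close>.
\<close>

section \<open>Deflation\<close>

lemma columnvector_mult_vec: "columnvector t *v c = (c $ 1) *\<^sub>R t"
  for t :: "real ^ 'n" and c :: "real ^ 1"
  by (simp add: vec_eq_iff columnvector_def matrix_vector_mult_def)

lemma transpose_columnvector_mult_vec: "(transpose (columnvector t) *v v) $ i = t \<bullet> v"
  for t :: "real ^ 'n" and i :: 1
  by (simp add: columnvector_def transpose_def matrix_vector_mult_def inner_vec_def)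

lemma matrix_1_mult_vec: "((A *v c) $ 1) = A $ 1 $ 1 * c $ 1" for A :: "real ^ 1 ^ 1"
  by (simp add: matrix_vector_mult_def)

text \<open>The equation behind the arbitrary choice becomes a scalar one, which for a nonzero entry
  has exactly one solution.\<close>

lemma generalized_inverse_1:
  fixes A :: "real ^ 1 ^ 1"
  assumes "A $ 1 $ 1 \<noteq> 0"
  shows "generalized_inverse A $ 1 $ 1 = 1 / A $ 1 $ 1"
proof -
  have "A ** (\<chi> i j. 1 / A $ 1 $ 1) ** A = A"
    using assms by (simp add: vec_eq_iff matrix_matrix_mult_def forall_1)
  then have "A ** generalized_inverse A ** A = A"
    unfolding generalized_inverse_def by (rule someI)
  then have "A $ 1 $ 1 * generalized_inverse A $ 1 $ 1 * A $ 1 $ 1 = A $ 1 $ 1"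
    by (simp add: vec_eq_iff matrix_matrix_mult_def forall_1 mult.commute)
  then show ?thesis
    using assms by (simp add: eq_divide_eq mult.commute)
qed

lemma proj_matrix_columnvector:
  fixes t v :: "real ^ 'n"
  assumes "t \<noteq> 0"
  shows "proj_matrix (columnvector t :: real ^ 1 ^ 'n) *v v = (t \<bullet> v / (t \<bullet> t)) *\<^sub>R t"
proof -
  let ?V = "columnvector t :: real ^ 1 ^ 'n"
  have gram: "(transpose ?V ** ?V) $ 1 $ 1 = t \<bullet> t"
    by (simp add: columnvector_def transpose_def matrix_matrix_mult_def inner_vec_def)
  show ?thesis
    using assms generalized_inverse_1[of "transpose ?V ** ?V"]
    by (simp add: proj_matrix_def columnvector_mult_vec matrix_1_mult_vec
        transpose_columnvector_mult_vec gram
        del: transpose_matrix_vector flip: matrix_vector_mul_assoc)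
qed

lemma ppls_X_Suc_0 [simp]: "ppls_X M X y (Suc 0) = X"
  by (simp add: ppls_X_def)

lemma ppls_X_Suc_Suc_mult_vec:
  assumes "ppls_component M X y (Suc k) \<noteq> 0"
  shows "ppls_X M X y (Suc (Suc k)) *v v =
    ppls_X M X y (Suc k) *v v -
    (ppls_component M X y (Suc k) \<bullet> (ppls_X M X y (Suc k) *v v)
      / (ppls_component M X y (Suc k) \<bullet> ppls_component M X y (Suc k)))
      *\<^sub>R ppls_component M X y (Suc k)"
proof -
  have "ppls_X M X y (Suc (Suc k)) = ppls_deflate M y (ppls_X M X y (Suc k))"
    by (simp add: ppls_X_def)
  then show ?thesis
    using proj_matrix_columnvector[OF assms]
    by (simp add: ppls_deflate_def ppls_component_def ppls_weight_def
        matrix_vector_mult_diff_rdistrib flip: matrix_vector_mul_assoc)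
qed

text \<open>Each deflation removes the direction of the newest component. Older components stay
  orthogonal because the removed vector lies in the range of the previous deflated matrix, which is
  orthogonal to them by induction.\<close>

lemma ppls_X_orthogonal:
  assumes "\<And>j. j < k \<Longrightarrow> ppls_component M X y (Suc j) \<noteq> 0" and "j < k"
  shows "ppls_component M X y (Suc j) \<bullet> (ppls_X M X y (Suc k) *v v) = 0"
  using assms
proof (induction k arbitrary: v)
  case (Suc k)
  have orth: "ppls_component M X y (Suc j) \<bullet> (ppls_X M X y (Suc k) *v x) = 0" if "j < k" for x
    using Suc that by simp
  have "ppls_component M X y (Suc j) \<bullet> ppls_component M X y (Suc k) = 0" if "j < k"
    using orth[OF that] by (simp add: ppls_component_def[of _ _ _ "Suc k"])
  with orth Suc.prems show ?case
    by (cases "j = k") (simp_all add: ppls_X_Suc_Suc_mult_vec inner_diff_right)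
qed simp

lemma ppls_component_orthogonal:
  assumes "\<And>i. i < k \<Longrightarrow> ppls_component M X y (Suc i) \<noteq> 0" and "i < k" "j < k" "i \<noteq> j"
  shows "ppls_component M X y (Suc i) \<bullet> ppls_component M X y (Suc j) = 0"
proof -
  have *: "ppls_component M X y (Suc i) \<bullet> ppls_component M X y (Suc j) = 0"
    if "i < j" "j < k" for i j
    unfolding ppls_component_def[of _ _ _ "Suc j"]
    using that assms(1) by (intro ppls_X_orthogonal) auto
  show ?thesis
    using assms *[of i j] *[of j i] by (cases "i < j") (auto simp: inner_commute)
qed

lemma ppls_X_mult_vec:
  assumes "\<And>j. j < k \<Longrightarrow> ppls_component M X y (Suc j) \<noteq> 0"
  shows "ppls_X M X y (Suc k) *v v =
    X *v v - (\<Sum>j<k. (ppls_component M X y (Suc j) \<bullet> (X *v v)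
      / (ppls_component M X y (Suc j) \<bullet> ppls_component M X y (Suc j)))
      *\<^sub>R ppls_component M X y (Suc j))"
  using assms
proof (induction k)
  case (Suc k)
  \<comment> \<open>Orthogonality lets the coefficient of the last deflation be computed from
    \<open>X\<close> instead of the deflated matrix.\<close>
  have "ppls_component M X y (Suc k) \<bullet> ppls_component M X y (Suc j) = 0" if "j < k" for j
    using that Suc.prems by (intro ppls_component_orthogonal[where k = "Suc k"]) auto
  then have "ppls_component M X y (Suc k) \<bullet> (ppls_X M X y (Suc k) *v v) =
      ppls_component M X y (Suc k) \<bullet> (X *v v)"
    using Suc by (simp add: inner_diff_right inner_sum_right)
  with Suc show ?case
    by (simp add: ppls_X_Suc_Suc_mult_vec algebra_simps)
qed simp

lemma inner_transpose_mult_vec: "x \<bullet> (transpose Z *v z) = (Z *v x) \<bullet> z"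
  for Z :: "real ^ 'a ^ 'b"
  using dot_lmul_matrix[of z Z x] by (simp add: inner_commute)

text \<open>The accumulated deflation is a self-adjoint projection, so it can be moved from
  \<open>X\<close> onto \<open>y\<close>.\<close>

lemma ppls_weight_eq_residual:
  assumes "\<And>j. j < k \<Longrightarrow> ppls_component M X y (Suc j) \<noteq> 0"
  shows "ppls_weight M X y (Suc k) =
    M *v (transpose X *v (y - (\<Sum>j<k. (ppls_component M X y (Suc j) \<bullet> y
      / (ppls_component M X y (Suc j) \<bullet> ppls_component M X y (Suc j)))
      *\<^sub>R ppls_component M X y (Suc j))))"
proof -
  have "transpose (ppls_X M X y (Suc k)) *v y =
    transpose X *v (y - (\<Sum>j<k. (ppls_component M X y (Suc j) \<bullet> y
      / (ppls_component M X y (Suc j) \<bullet> ppls_component M X y (Suc j)))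
      *\<^sub>R ppls_component M X y (Suc j)))"
    by (rule vector_eq_rdot[THEN iffD1], intro allI)
      (simp add: inner_transpose_mult_vec ppls_X_mult_vec[OF assms] inner_diff_left
        inner_diff_right inner_sum_left inner_sum_right inner_commute mult.commute
        del: transpose_matrix_vector)
  then show ?thesis
    by (simp add: ppls_weight_def ppls_weight_of_def)
qed

section \<open>Conjugate gradients on the preconditioned normal equations\<close>

lemma invertible_positive_definite:
  assumes "positive_definite B"
  shows "invertible B"
proof -
  have "B *v x = 0 \<Longrightarrow> x = 0" for x
    using assms unfolding positive_definite_def by (metis inner_zero_right less_irrefl)
  then show ?thesis
    by (simp add: invertible_left_inverse matrix_left_invertible_ker)
qed

lemma matrix_inv_inverse:
  fixes B :: "real ^ 'p ^ 'p"
  assumes "invertible B"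
  shows "B ** matrix_inv B = mat 1" and "matrix_inv B ** B = mat 1"
  using assms someI_ex[of "\<lambda>C. B ** C = mat 1 \<and> C ** B = mat 1"]
  by (auto simp: invertible_def matrix_inv_def)

text \<open>Lets the inner product given by \<open>matrix_inv M\<close> cancel the leading factor
  \<open>M\<close> of the preconditioned system.\<close>

lemma matrix_inv_matrix_inv_mult_vec:
  fixes B :: "real ^ 'p ^ 'p"
  assumes "invertible B" and "M = matrix_inv B"
  shows "matrix_inv M *v (M *v x) = x"
proof -
  have "M ** B = mat 1" "B ** M = mat 1"
    using assms by (simp_all add: matrix_inv_inverse)
  then have "invertible M"
    unfolding invertible_def by blast
  then show ?thesis
    by (simp add: matrix_inv_inverse matrix_vector_mul_assoc)
qed

text \<open>Components are renumbered from 0 to match the search directions. For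
  \<open>k \<le> m\<close>, \<open>fit k\<close> is the projection of \<open>y\<close> onto the span
  of the first \<open>k\<close> components.\<close>

locale ppls_cg =
  fixes X :: "real ^ 'p ^ 'n" and y :: "real ^ 'n" and M :: "real ^ 'p ^ 'p"
    and m :: nat and t and \<beta> d and fit
  defines "t \<equiv> \<lambda>i. ppls_component M X y (Suc i)"
    and "\<beta> \<equiv> cg_iter (matrix_inner (matrix_inv M)) (M ** (transpose X ** X)) (M *v (transpose X *v y))"
    and "d \<equiv> cg_dir (matrix_inner (matrix_inv M)) (M ** (transpose X ** X)) (M *v (transpose X *v y))"
    and "fit \<equiv> \<lambda>k. \<Sum>j<k. (t j \<bullet> y / (t j \<bullet> t j)) *\<^sub>R t j"
  assumes inv: "\<And>x. matrix_inv M *v (M *v x) = x"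
    and nz: "\<And>i. i < m \<Longrightarrow> t i \<noteq> 0"
begin

lemma t_orthogonal: "\<lbrakk>i < m; j < m; i \<noteq> j\<rbrakk> \<Longrightarrow> t i \<bullet> t j = 0"
  using nz unfolding t_def by (rule ppls_component_orthogonal)

lemma residual:
  "M *v (transpose X *v y) - (M ** (transpose X ** X)) *v v = M *v (transpose X *v (y - X *v v))"
  by (simp add: matrix_vector_mult_diff_distrib flip: matrix_vector_mul_assoc)

lemma ip_precond: "matrix_inner (matrix_inv M) u (M *v (transpose X *v z)) = (X *v u) \<bullet> z"
  by (simp add: matrix_inner_def inv inner_transpose_mult_vec del: transpose_matrix_vector)

lemma ip_normal: "matrix_inner (matrix_inv M) u ((M ** (transpose X ** X)) *v v) = (X *v u) \<bullet> (X *v v)"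
  using ip_precond[of u "X *v v"] by (simp flip: matrix_vector_mul_assoc)

lemma beta_0: "\<beta> 0 = 0"
  by (simp add: \<beta>_def)

lemma beta_Suc: "\<beta> (Suc k) =
    \<beta> k + ((X *v d k) \<bullet> (y - X *v \<beta> k) / ((X *v d k) \<bullet> (X *v d k))) *\<^sub>R d k"
  by (simp add: \<beta>_def d_def Let_def residual ip_precond ip_normal
      del: transpose_matrix_vector)

text \<open>For \<open>k = 0\<close> the sum is empty, so one formula covers the initial direction
  as well.\<close>

lemma dir: "d k = M *v (transpose X *v (y - X *v \<beta> k)) -
    (\<Sum>i<k. ((X *v (M *v (transpose X *v (y - X *v \<beta> k)))) \<bullet> (X *v d i)
      / ((X *v d i) \<bullet> (X *v d i))) *\<^sub>R d i)"
proof (cases k)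
  case 0
  then show ?thesis
    by (simp add: \<beta>_def d_def residual)
next
  case (Suc n)
  show ?thesis
    unfolding \<beta>_def d_def Suc
    by (subst cg_dir.simps(2)) (simp only: Let_def residual ip_normal atLeast0AtMost lessThan_Suc_atMost)
qed

lemma weight: "k < m \<Longrightarrow> ppls_weight M X y (Suc k) = M *v (transpose X *v (y - fit k))"
  using nz unfolding fit_def t_def by (intro ppls_weight_eq_residual) auto

lemma component: "k < m \<Longrightarrow> t k = X *v ppls_weight M X y (Suc k) -
    (\<Sum>j<k. (t j \<bullet> (X *v ppls_weight M X y (Suc k)) / (t j \<bullet> t j)) *\<^sub>R t j)"
  using nz unfolding t_def
  by (subst ppls_component_def, intro ppls_X_mult_vec) auto

lemma t_inner_fit: "k < m \<Longrightarrow> t k \<bullet> fit k = 0"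
  by (simp add: fit_def inner_sum_right t_orthogonal)

text \<open>All three claims go through one induction: the fit identifies the residual with the next
  weight, and the earlier images then make the coefficients for \<open>d k\<close> equal to those
  for \<open>t k\<close>.\<close>

lemma cg_invariant:
  assumes "k \<le> m"
  shows "X *v \<beta> k = fit k" and "\<And>j. j < k \<Longrightarrow> X *v d j = t j"
    and "\<beta> k = (\<Sum>j<k. (t j \<bullet> y / (t j \<bullet> t j)) *\<^sub>R d j)"
proof -
  have "X *v \<beta> k = fit k \<and> (\<forall>j<k. X *v d j = t j) \<and>
      \<beta> k = (\<Sum>j<k. (t j \<bullet> y / (t j \<bullet> t j)) *\<^sub>R d j)"
    using assms
  proof (induction k)
    case 0
    then show ?case by (simp add: beta_0 fit_def)
  next
    case (Suc k)
    then have fit: "X *v \<beta> k = fit k" and Xd: "\<And>j. j < k \<Longrightarrow> X *v d j = t j"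
      and beta: "\<beta> k = (\<Sum>j<k. (t j \<bullet> y / (t j \<bullet> t j)) *\<^sub>R d j)" and "k < m"
      by auto
    have "d k = ppls_weight M X y (Suc k) -
        (\<Sum>i<k. (t i \<bullet> (X *v ppls_weight M X y (Suc k)) / (t i \<bullet> t i)) *\<^sub>R d i)"
      using \<open>k < m\<close> by (subst dir) (simp add: fit Xd weight inner_commute)
    then have Xdk: "X *v d k = t k"
      using component[OF \<open>k < m\<close>]
      by (simp add: matrix_vector_mult_diff_distrib linear_sum[OF matrix_vector_mul_linear]
          matrix_vector_mult_scaleR Xd)
    \<comment> \<open>Since \<open>t k\<close> is orthogonal to \<open>fit k\<close>, the residual
      \<open>y - fit k\<close> in the step length may be replaced by \<open>y\<close>.\<close>
    have step: "\<beta> (Suc k) = \<beta> k + (t k \<bullet> y / (t k \<bullet> t k)) *\<^sub>R d k"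
      by (simp add: beta_Suc Xdk fit inner_diff_right t_inner_fit \<open>k < m\<close>)
    show ?case
      using step beta Xd Xdk fit
      by (auto simp: less_Suc_eq fit_def matrix_vector_right_distrib matrix_vector_mult_scaleR)
  qed
  then show "X *v \<beta> k = fit k" and "\<And>j. j < k \<Longrightarrow> X *v d j = t j"
    and "\<beta> k = (\<Sum>j<k. (t j \<bullet> y / (t j \<bullet> t j)) *\<^sub>R d j)"
    by auto
qed

section \<open>Search directions as effective weights\<close>

lemma dir_weight:
  assumes "k < m"
  shows "d k = ppls_weight M X y (Suc k) -
    (\<Sum>i<k. (t i \<bullet> (X *v ppls_weight M X y (Suc k)) / (t i \<bullet> t i)) *\<^sub>R d i)"
  using assms cg_invariant[of k] by (subst dir) (simp add: weight inner_commute)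

lemma dir_in_span_weights: "k < m \<Longrightarrow> d k \<in> span (ppls_weight M X y ` {1..Suc k})"
proof (induction k rule: less_induct)
  case (less k)
  have "d i \<in> span (ppls_weight M X y ` {1..Suc k})" if "i < k" for i
    using less that span_mono[of "ppls_weight M X y ` {1..Suc i}" "ppls_weight M X y ` {1..Suc k}"]
    by (fastforce simp: image_mono)
  then show ?case
    by (subst dir_weight[OF less.prems])
      (auto intro!: span_diff span_sum span_scale intro: span_base)
qed

text \<open>The \<open>d j\<close> for \<open>j < k\<close> have orthogonal images under \<open>X\<close>, so \<open>X v\<close> determines the
  coordinates of \<open>v\<close>.\<close>

lemma expand_in_span_weights:
  assumes "k \<le> m" and "v \<in> span (ppls_weight M X y ` {1..k})"
  shows "v = (\<Sum>j<k. (t j \<bullet> (X *v v) / (t j \<bullet> t j)) *\<^sub>R d j)"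
proof -
  let ?E = "\<lambda>v. \<Sum>j<k. (t j \<bullet> (X *v v) / (t j \<bullet> t j)) *\<^sub>R d j"
  have lin: "linear ?E"
    by (rule linearI) (simp_all add: matrix_vector_right_distrib matrix_vector_mult_scaleR
        inner_add_right add_divide_distrib scaleR_left_distrib sum.distrib scaleR_sum_right)
  have E_dir: "?E (d i) = d i" if "i < k" for i
  proof -
    have "?E (d i) = (\<Sum>j<k. if j = i then d i else 0)"
      using that assms(1) nz by (intro sum.cong) (auto simp: cg_invariant(2)[OF assms(1)] t_orthogonal)
    then show ?thesis
      using that by simp
  qed
  \<comment> \<open>Solving the recursion for the weight writes it as a combination of directions,
    all fixed by the linear map \<open>?E\<close>.\<close>
  have "?E (ppls_weight M X y i) = ppls_weight M X y i" if i: "i \<in> {1..k}" for i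
  proof -
    obtain n where n: "i = Suc n" "n < k"
      using i by (cases i) auto
    then have w: "ppls_weight M X y i =
        d n + (\<Sum>j<n. (t j \<bullet> (X *v ppls_weight M X y i) / (t j \<bullet> t j)) *\<^sub>R d j)"
      using dir_weight[of n] assms(1) by simp
    show ?thesis
      by (subst (1 2) w, simp only: linear_add[OF lin] linear_sum[OF lin] linear_scale[OF lin])
        (use n E_dir in simp)
  qed
  then have "?E v = id v"
    by (intro linear_eq_on[OF lin linear_id assms(2)]) auto
  then show ?thesis
    by simp
qed

text \<open>Uniqueness holds because the expansion of a vector in the span of the weights depends
  only on its image under \<open>X\<close>.\<close>

lemma effective_weight:
  assumes "k < m"
  shows "ppls_effective_weight M X y (Suc k) = d k"
  unfolding ppls_effective_weight_def
proof (rule the_equality)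
  have Xd: "X *v d k = ppls_component M X y (Suc k)"
    using cg_invariant(2)[of "Suc k"] assms by (simp add: t_def)
  with assms show in_span: "d k \<in> span (ppls_weight M X y ` {1..Suc k}) \<and>
      X *v d k = ppls_component M X y (Suc k)"
    using dir_in_span_weights by blast
  fix w
  assume "w \<in> span (ppls_weight M X y ` {1..Suc k}) \<and> X *v w = ppls_component M X y (Suc k)"
  with in_span show "w = d k"
    using assms expand_in_span_weights[of "Suc k" w] expand_in_span_weights[of "Suc k" "d k"]
    by simp
qed

lemma ppls_beta_eq_cg: "ppls_beta M X y m = \<beta> m"
proof -
  have "ppls_beta M X y m = (\<Sum>j<m. (t j \<bullet> y / (t j \<bullet> t j)) *\<^sub>R ppls_effective_weight M X y (Suc j))"
    unfolding ppls_beta_def t_def by (simp add: sum.atLeast1_atMost_eq)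
  also have "\<dots> = \<beta> m"
    by (simp add: cg_invariant(3) effective_weight)
  finally show ?thesis .
qed

end

theorem theorem6:
  fixes X :: "real ^ 'p ^ 'n" and y :: "real ^ 'n"
    and P M A A\<^sub>M :: "real ^ 'p ^ 'p" and b b\<^sub>M :: "real ^ 'p" and m :: nat
  assumes "centered_matrix X" and "centered y"
    and "symmetric_matrix P" and "positive_definite (mat 1 + P)"
    and "M = matrix_inv (mat 1 + P)"
    and "A = transpose X ** X" and "b = transpose X *v y"
    and "A\<^sub>M = M ** A" and "b\<^sub>M = M *v b"
    and "m \<ge> 1" and "\<forall>i\<in>{1..m}. ppls_component M X y i \<noteq> 0"
  shows "ppls_beta M X y m = cg_iter (matrix_inner (matrix_inv M)) A\<^sub>M b\<^sub>M m"
proof -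
  interpret ppls_cg X y M m "\<lambda>i. ppls_component M X y (Suc i)"
    "cg_iter (matrix_inner (matrix_inv M)) (M ** (transpose X ** X)) (M *v (transpose X *v y))"
    "cg_dir (matrix_inner (matrix_inv M)) (M ** (transpose X ** X)) (M *v (transpose X *v y))"
    "\<lambda>k. \<Sum>j<k. (ppls_component M X y (Suc j) \<bullet> y
      / (ppls_component M X y (Suc j) \<bullet> ppls_component M X y (Suc j)))
      *\<^sub>R ppls_component M X y (Suc j)"
    using assms by unfold_locales
      (auto intro: matrix_inv_matrix_inv_mult_vec[OF invertible_positive_definite])
  show ?thesis
    using ppls_beta_eq_cg assms by simp
qed

end
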